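(* Let $\mathfrak{g}$ be a Lie algebra over $\mathbb{C}$ (not necessarily finite-dimensional) equipped with a nondegenerate symmetric invariant bilinear form, let $\hat{\mathfrak{g}}$ be the associated affine Lie algebra, and let $\pi:\hat{\mathfrak{g}}\to\mathrm{End}\,W$ be a representation of $\hat{\mathfrak{g}}$ on a module $W$ in the category $\mathcal{C}$. Define linear maps $\pi_{\mathcal{R}},\pi_{\mathcal{E}}:\hat{\mathfrak{g}}\to\mathrm{End}\,W$ in terms of generating functions by $$\pi_{\mathcal{R}}(a(x)+\alpha\mathbf{k})=\psi_{\mathcal{R}}(\pi(a(x)))+\alpha\pi(\mathbf{k}),\qquad \pi_{\mathcal{E}}(a(x)+\beta\mathbf{k})=\psi_{\mathcal{E}}(\pi(a(x)))$$ for $a\in\mathfrak{g}$, $\alpha,\beta\in\mathbb{C}$. Then $\pi=\pi_{\mathcal{R}}+\pi_{\mathcal{E}}$, and the linear map $$\hat{\mathfrak{g}}\oplus\hat{\mathfrak{g}}\to\mathrm{End}\,W,\qquad (u,v)\mapsto\pi_{\mathcal{R}}(u)+\pi_{\mathcal{E}}(v)$$ defines a representation of the direct sum Lie algebra $\hat{\mathfrak{g}}\oplus\hat{\mathfrak{g}}$ on $W$. If $(W,\pi)$ is irreducible, then $W$ is an irreducible $\hat{\mathfrak{g}}\oplus\hat{\mathfrak{g}}$-module. Furthermore, $(W,\pi_{\mathcal{R}})$ is a restricted $\hat{\mathfrak{g}}$-module and $(W,\pi_{\mathcal{E}})$ is a $\hat{\mathfrak{g}}$-module in the category $\mathcal{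E}$.
   Context: The affine Lie algebra is $\hat{\mathfrak{g}}=\mathfrak{g}\otimes\mathbb{C}[t,t^{-1}]\oplus\mathbb{C}\mathbf{k}$ with $\mathbf{k}$ central and $[a\otimes t^{m},b\otimes t^{n}]=[a,b]\otimes t^{m+n}+m\langle a,b\rangle\delta_{m+n,0}\mathbf{k}$. For $a\in\mathfrak{g}$, $a(x)=\sum_{n\in\mathbb{Z}}(a\otimes t^n)x^{-n-1}\in\hat{\mathfrak{g}}[[x,x^{-1}]]$; $\pi$ is extended coefficientwise to $\hat{\mathfrak{g}}[[x,x^{-1}]]$. On a module, $a(n)$ denotes the operator of $a\otimes t^n$ and $a(x)$ also denotes the corresponding series of operators. A $\hat{\mathfrak{g}}$-module $W$ is restricted (in the category $\mathcal{R}$) if $a(x)w\in W((x))$ for all $a\in\mathfrak{g}$, $w\in W$ (equivalently $a(n)w=0$ for $n$ sufficiently large). It is in $\mathcal{E}$ if there is a nonzero $p(x)\in\mathbb{C}[x]$ with $p(x)a(x)w=0$ for all $a\in\mathfrak{g}$, $w\in W$. It is in $\mathcal{C}$ if there is a nonzero $p(x)\in\mathbb{C}[x]$ with $p(x)a(x)w\in W((x))$ for all $a\in\mathfrak{g}$, $w\in W$. Here $W((x))$ is the space of lower truncated formal Laurent series. For a vector space $W$, let $\bar{\mathcal{E}}(W)$ be the space of $b(x)\in(\mathrm{End}\,W)[[x,x^{-1}]]$ such that $f(x)b(x)\in\mathrm{Hom}(W,W((x)))$ for some nonzero polynomial $f(x)$. Let $\iota_{x;0}:\mathbb{C}(x)\to\mathbb{C}((x))$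 be Laurent expansion at $0$. The map $\psi_{\mathcal{R}}:\bar{\mathcal{E}}(W)\to\mathrm{Hom}(W,W((x)))$ is defined by $\psi_{\mathcal{R}}(b(x))w=\iota_{x;0}(f(x)^{-1})\,(f(x)b(x)w)$ for $w\in W$, where $f(x)$ is any nonzero polynomial with $f(x)b(x)\in\mathrm{Hom}(W,W((x)))$ (the result is independent of $f$), and $\psi_{\mathcal{E}}(b(x))=b(x)-\psi_{\mathcal{R}}(b(x))$. Explicitly, $\pi_{\mathcal{R}}(a\otimes t^n)$ and $\pi_{\mathcal{E}}(a\otimes t^n)$ are the coefficients of $x^{-n-1}$ in $\psi_{\mathcal{R}}(\pi(a(x)))$ and $\psi_{\mathcal{E}}(\pi(a(x)))$, while $\pi_{\mathcal{R}}(\mathbf{k})=\pi(\mathbf{k})$ and $\pi_{\mathcal{E}}(\mathbf{k})=0$. *)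

theory Defs
  imports
    Complex_Main
    "HOL-Library.Poly_Mapping"
    "HOL-Library.Product_Plus"
    "HOL-Computational_Algebra.Computational_Algebra"
    "HOL-Computational_Algebra.Field_as_Ring"
begin

section \<open>Lie algebras and their modules\<close>

locale lie_algebra = vector_space scale
  for scale :: "complex \<Rightarrow> 'a::ab_group_add \<Rightarrow> 'a" +
  fixes bracket :: "'a \<Rightarrow> 'a \<Rightarrow> 'a"
  assumes bracket_linear_right: "\<And>x. Vector_Spaces.linear scale scale (bracket x)"
    and bracket_linear_left: "\<And>y. Vector_Spaces.linear scale scale (\<lambda>x. bracket x y)"
    and bracket_self: "\<And>x. bracket x x = 0"
    and jacobi: "\<And>x y z. bracket x (bracket y z) + bracket y (bracket z x) + bracket z (bracket x y) = 0"

locale lie_algebra_with_form = lie_algebra scale bracket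
  for scale :: "complex \<Rightarrow> 'a::ab_group_add \<Rightarrow> 'a" and bracket +
  fixes form :: "'a \<Rightarrow> 'a \<Rightarrow> complex"
  assumes form_linear_right: "\<And>x. Vector_Spaces.linear scale (*) (form x)"
    and form_linear_left: "\<And>y. Vector_Spaces.linear scale (*) (\<lambda>x. form x y)"
    and form_symmetric: "\<And>x y. form x y = form y x"
    and form_invariant: "\<And>x y z. form (bracket x y) z = form x (bracket y z)"
    and form_nondegenerate: "\<And>x. (\<And>y. form x y = 0) \<Longrightarrow> x = 0"

locale lie_module = L: lie_algebra scaleL bracketL + W: vector_space scaleW
  for scaleL :: "complex \<Rightarrow> 'l::ab_group_add \<Rightarrow> 'l" and bracketL
    and scaleW :: "complex \<Rightarrow> 'w::ab_group_add \<Rightarrow> 'w" +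
  fixes \<rho> :: "'l \<Rightarrow> 'w \<Rightarrow> 'w"
  assumes operator_linear: "\<And>u. Vector_Spaces.linear scaleW scaleW (\<rho> u)"
    and rep_add: "\<And>u v w. \<rho> (u + v) w = \<rho> u w + \<rho> v w"
    and rep_scale: "\<And>c u w. \<rho> (scaleL c u) w = scaleW c (\<rho> u w)"
    and rep_bracket: "\<And>u v w. \<rho> (bracketL u v) w = \<rho> u (\<rho> v w) - \<rho> v (\<rho> u w)"

definition irreducible_lie_module ::
    "(complex \<Rightarrow> 'l::ab_group_add \<Rightarrow> 'l) \<Rightarrow> ('l \<Rightarrow> 'l \<Rightarrow> 'l) \<Rightarrow>
     (complex \<Rightarrow> 'w::ab_group_add \<Rightarrow> 'w) \<Rightarrow> ('l \<Rightarrow> 'w \<Rightarrow> 'w) \<Rightarrow> bool" where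
  "irreducible_lie_module scaleL bracketL scaleW \<rho> \<longleftrightarrow>
     lie_module scaleL bracketL scaleW \<rho> \<and>
     (\<exists>w::'w. w \<noteq> 0) \<and>
     (\<forall>S. module.subspace scaleW S \<and> (\<forall>u. \<forall>w\<in>S. \<rho> u w \<in> S) \<longrightarrow> S = {0} \<or> S = UNIV)"

definition prod_scale ::
    "(complex \<Rightarrow> 'a \<Rightarrow> 'a) \<Rightarrow> (complex \<Rightarrow> 'b \<Rightarrow> 'b) \<Rightarrow> complex \<Rightarrow> 'a \<times> 'b \<Rightarrow> 'a \<times> 'b" where
  "prod_scale s1 s2 c = map_prod (s1 c) (s2 c)"

definition prod_bracket ::
    "('a \<Rightarrow> 'a \<Rightarrow> 'a) \<Rightarrow> ('b \<Rightarrow> 'b \<Rightarrow> 'b) \<Rightarrow> 'a \<times> 'b \<Rightarrow> 'a \<times> 'b \<Rightarrow> 'a \<times> 'b" where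
  "prod_bracket br1 br2 x y = (br1 (fst x) (fst y), br2 (snd x) (snd y))"

lemma prod_lie_algebra:
  assumes "lie_algebra s1 br1" "lie_algebra s2 br2"
  shows "lie_algebra (prod_scale s1 s2) (prod_bracket br1 br2)"
proof -
  interpret A: lie_algebra s1 br1 by fact
  interpret B: lie_algebra s2 br2 by fact
  note ar = Vector_Spaces.linear_iff[THEN iffD1, OF A.bracket_linear_right]
  note al = Vector_Spaces.linear_iff[THEN iffD1, OF A.bracket_linear_left]
  note bbr = Vector_Spaces.linear_iff[THEN iffD1, OF B.bracket_linear_right]
  note bl = Vector_Spaces.linear_iff[THEN iffD1, OF B.bracket_linear_left]
  have V: "vector_space (prod_scale s1 s2)"
    by unfold_locales
      (auto simp: prod_scale_def A.scale_right_distrib A.scale_left_distrib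
        B.scale_right_distrib B.scale_left_distrib)
  interpret V: vector_space "prod_scale s1 s2" by (rule V)
  show ?thesis
  proof (intro lie_algebra.intro lie_algebra_axioms.intro)
    show "vector_space (prod_scale s1 s2)" by (rule V)
    show "Vector_Spaces.linear (prod_scale s1 s2) (prod_scale s1 s2) (prod_bracket br1 br2 x)" for x
      using ar bbr V by (auto simp: Vector_Spaces.linear_iff prod_scale_def prod_bracket_def)
    show "Vector_Spaces.linear (prod_scale s1 s2) (prod_scale s1 s2)
        (\<lambda>x. prod_bracket br1 br2 x y)" for y
      using al bl V by (auto simp: Vector_Spaces.linear_iff prod_scale_def prod_bracket_def)
    show "prod_bracket br1 br2 x x = 0" for x
      by (simp add: prod_bracket_def A.bracket_self B.bracket_self zero_prod_def)
    show "prod_bracket br1 br2 x (prod_bracket br1 br2 y z) +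
        prod_bracket br1 br2 y (prod_bracket br1 br2 z x) +
        prod_bracket br1 br2 z (prod_bracket br1 br2 x y) = 0" for x y z
      by (simp add: prod_bracket_def A.jacobi B.jacobi zero_prod_def)
  qed
qed


section \<open>The affine Lie algebra\<close>

text \<open>
  The tensor product of \<open>'g\<close> with the Laurent polynomials is encoded as the space of finitely
  supported functions from the integers to \<open>'g\<close>: the value at \<open>n\<close> is the coefficient of \<open>t\<^sup>n\<close>.
  The second component is the coefficient of the central element.
\<close>

type_synonym 'g affine = "(int \<Rightarrow>\<^sub>0 'g) \<times> complex"

definition affine_elem :: "'g::ab_group_add \<Rightarrow> int \<Rightarrow> 'g affine" where
  "affine_elem a n = (Poly_Mapping.single n a, 0)"

definition affine_k :: "'g::ab_group_add affine" where
  "affine_k = (0, 1)"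

definition affine_scale ::
    "(complex \<Rightarrow> 'g::ab_group_add \<Rightarrow> 'g) \<Rightarrow> complex \<Rightarrow> 'g affine \<Rightarrow> 'g affine" where
  "affine_scale s = prod_scale (\<lambda>c. Poly_Mapping.map (s c)) (*)"

definition affine_bracket ::
    "('g::ab_group_add \<Rightarrow> 'g \<Rightarrow> 'g) \<Rightarrow> ('g \<Rightarrow> 'g \<Rightarrow> complex) \<Rightarrow>
     'g affine \<Rightarrow> 'g affine \<Rightarrow> 'g affine" where
  "affine_bracket br form x y =
     (\<Sum>m\<in>Poly_Mapping.keys (fst x). \<Sum>n\<in>Poly_Mapping.keys (fst y).
        let a = Poly_Mapping.lookup (fst x) m; b = Poly_Mapping.lookup (fst y) n
        in (Poly_Mapping.single (m + n) (br a b),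
            if m + n = 0 then of_int m * form a b else 0))"

lemma affine_induct [case_names elem central add]:
  fixes x :: "'g::ab_group_add affine"
  assumes elem: "\<And>a n. P (affine_elem a n)"
    and central: "\<And>c. P (0, c)"
    and add: "\<And>x y. P x \<Longrightarrow> P y \<Longrightarrow> P (x + y)"
  shows "P x"
proof -
  have single: "P (f, 0)" for f :: "int \<Rightarrow>\<^sub>0 'g"
  proof (induction f rule: update_induct)
    case const
    show ?case by (rule central)
  next
    case (update f a b)
    have "Poly_Mapping.update a b f = f + Poly_Mapping.single a b"
      using update.hyps
      by (intro poly_mapping_eqI)
        (auto simp: lookup_update lookup_add lookup_single in_keys_iff when_def)
    then have "(Poly_Mapping.update a b f, 0::complex) = (f, 0) + affine_elem b a"
      by (simp add: affine_elem_def)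
    then show ?case using add[OF update.IH elem] by simp
  qed
  have "x = (fst x, 0) + (0, snd x)" by (simp add: prod_eq_iff)
  then show ?thesis using add[OF single central] by metis
qed

lemma
  assumes "lie_algebra_with_form sg br form"
  shows affine_lie_algebra: "lie_algebra (affine_scale sg) (affine_bracket br form)"
    and affine_bracket_elem:
      "affine_bracket br form (affine_elem a m) (affine_elem b n) =
         affine_elem (br a b) (m + n) +
         (if m + n = 0 then affine_scale sg (of_int m * form a b) affine_k else 0)"
    and affine_bracket_k: "affine_bracket br form affine_k x = 0"
proof -
  interpret G: lie_algebra_with_form sg br form by fact
  note gr = Vector_Spaces.linear_iff[THEN iffD1, OF G.bracket_linear_right]
  note gl = Vector_Spaces.linear_iff[THEN iffD1, OF G.bracket_linear_left]
  note fr = Vector_Spaces.linear_iff[THEN iffD1, OF G.form_linear_right]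
  note fl = Vector_Spaces.linear_iff[THEN iffD1, OF G.form_linear_left]
  have br_add: "br (a + a') b = br a b + br a' b" "br a (b + b') = br a b + br a b'"
    and br_scale: "br (sg c a) b = sg c (br a b)" "br a (sg c b) = sg c (br a b)"
    and fo_add: "form (a + a') b = form a b + form a' b" "form a (b + b') = form a b + form a b'"
    and fo_scale: "form (sg c a) b = c * form a b" "form a (sg c b) = c * form a b" for a a' b b' c
    using gr gl fr fl by auto
  have br_0: "br 0 b = 0" "br a 0 = 0" and fo_0: "form 0 b = 0" "form a 0 = 0" for a b
    using br_add(1)[of 0 0 b] br_add(2)[of a 0 0] fo_add(1)[of 0 0 b] fo_add(2)[of a 0 0] by auto
  have br_skew: "br a b = - br b a" for a b
  proof -
    have "br (a + b) (a + b) = 0" by (rule G.bracket_self)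
    then have "br a b + br b a = 0"
      unfolding br_add by (simp add: G.bracket_self add.commute)
    then show ?thesis by (rule eq_neg_iff_add_eq_0[THEN iffD2])
  qed
  let ?B = "affine_bracket br form"
  define t where "t m n a b = (Poly_Mapping.single (m + n) (br a b),
      if m + n = 0 then of_int m * form a b else 0)" for m n :: int and a b
  have t_0: "t m n 0 b = 0" "t m n a 0 = 0" for m n a b
    by (auto simp: t_def br_0 fo_0 zero_prod_def)
  have t_add: "t m n (a + a') b = t m n a b + t m n a' b"
       "t m n a (b + b') = t m n a b + t m n a b'" for m n a a' b b'
    by (auto simp: t_def br_add fo_add single_add algebra_simps)
  have map_add: "Poly_Mapping.map (sg c) (f + g) = Poly_Mapping.map (sg c) f + Poly_Mapping.map (sg c) g"
    for c and f g :: "int \<Rightarrow>\<^sub>0 'a"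
    by (intro poly_mapping_eqI)
      (auto simp: map.rep_eq lookup_add when_def G.scale_right_distrib[symmetric])
  have map_single: "Poly_Mapping.map (sg c) (Poly_Mapping.single n a) = Poly_Mapping.single n (sg c a)"
    for c n a
    by (intro poly_mapping_eqI) (auto simp: map.rep_eq lookup_single when_def)
  have map_0: "Poly_Mapping.map (sg c) (0 :: int \<Rightarrow>\<^sub>0 'a) = 0" for c
    by (intro poly_mapping_eqI) (simp add: map.rep_eq)
  have t_scale: "t m n (sg c a) b = affine_scale sg c (t m n a b)"
       "t m n a (sg c b) = affine_scale sg c (t m n a b)" for m n a b c
    by (auto simp: t_def br_scale fo_scale affine_scale_def prod_scale_def map_single)
  have lookup_map: "Poly_Mapping.lookup (Poly_Mapping.map (sg c) f) n = sg c (Poly_Mapping.lookup f n)"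
    for c n and f :: "int \<Rightarrow>\<^sub>0 'a"
    by (simp add: map.rep_eq when_def)
  have V: "vector_space (affine_scale sg)"
    by unfold_locales
      (auto simp: affine_scale_def prod_scale_def lookup_map lookup_add map_add
        G.scale_left_distrib algebra_simps intro!: poly_mapping_eqI)
  interpret V: vector_space "affine_scale sg" by (rule V)
  have B_eq: "?B x y = (\<Sum>m\<in>S. \<Sum>n\<in>T. t m n (Poly_Mapping.lookup (fst x) m) (Poly_Mapping.lookup (fst y) n))"
    if "finite S" "finite T" "Poly_Mapping.keys (fst x) \<subseteq> S" "Poly_Mapping.keys (fst y) \<subseteq> T" for x y S T
  proof -
    have "?B x y = (\<Sum>m\<in>Poly_Mapping.keys (fst x). \<Sum>n\<in>Poly_Mapping.keys (fst y).
        t m n (Poly_Mapping.lookup (fst x) m) (Poly_Mapping.lookup (fst y) n))"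
      by (simp add: affine_bracket_def t_def Let_def)
    also have "\<dots> = (\<Sum>m\<in>Poly_Mapping.keys (fst x). \<Sum>n\<in>T.
        t m n (Poly_Mapping.lookup (fst x) m) (Poly_Mapping.lookup (fst y) n))"
      using that by (intro sum.cong refl sum.mono_neutral_left) (auto simp: t_0 in_keys_iff)
    also have "\<dots> = (\<Sum>m\<in>S. \<Sum>n\<in>T.
        t m n (Poly_Mapping.lookup (fst x) m) (Poly_Mapping.lookup (fst y) n))"
      using that by (intro sum.mono_neutral_left) (auto simp: t_0 in_keys_iff)
    finally show ?thesis .
  qed
  have keys_plus: "Poly_Mapping.keys (fst (x + y)) \<subseteq> Poly_Mapping.keys (fst x) \<union> Poly_Mapping.keys (fst y)"
    for x y :: "'a affine"
    by (simp add: Poly_Mapping.keys_add)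
  have keys_sc: "Poly_Mapping.keys (fst (affine_scale sg c x)) \<subseteq> Poly_Mapping.keys (fst x)" for c x
    by (auto simp: affine_scale_def prod_scale_def in_keys_iff lookup_map)
  have B_addl: "?B (x + x') y = ?B x y + ?B x' y" for x x' y
    using keys_plus[of x x']
    by (simp add: B_eq[of "Poly_Mapping.keys (fst x) \<union> Poly_Mapping.keys (fst x')"
          "Poly_Mapping.keys (fst y)"] lookup_add t_add sum.distrib)
  have B_addr: "?B x (y + y') = ?B x y + ?B x y'" for x y y'
    using keys_plus[of y y']
    by (simp add: B_eq[of "Poly_Mapping.keys (fst x)"
          "Poly_Mapping.keys (fst y) \<union> Poly_Mapping.keys (fst y')"] lookup_add t_add sum.distrib)
  have fst_sc: "Poly_Mapping.lookup (fst (affine_scale sg c x)) m = sg c (Poly_Mapping.lookup (fst x) m)" for c x m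
    by (simp add: affine_scale_def prod_scale_def lookup_map)
  have B_scl: "?B (affine_scale sg c x) y = affine_scale sg c (?B x y)" for c x y
    using keys_sc[of c x]
    by (simp add: B_eq[of "Poly_Mapping.keys (fst x)" "Poly_Mapping.keys (fst y)"]
        fst_sc t_scale V.scale_sum_right)
  have B_scr: "?B x (affine_scale sg c y) = affine_scale sg c (?B x y)" for c x y
    using keys_sc[of c y]
    by (simp add: B_eq[of "Poly_Mapping.keys (fst x)" "Poly_Mapping.keys (fst y)"]
        fst_sc t_scale V.scale_sum_right)
  have B_el: "?B (affine_elem a m) (affine_elem b n) = t m n a b" for a b m n
    by (subst B_eq[of "{m}" "{n}"]) (auto simp: affine_elem_def)
  have B_k: "?B (0, c) x = 0" "?B x (0, c) = 0" for c x
    by (auto simp: affine_bracket_def)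
  have t_skew: "t m n a b = - t n m b a" for m n a b
    using br_skew[of a b] G.form_symmetric[of a b]
    by (auto simp: t_def single_uminus add.commute eq_neg_iff_add_eq_0 simp flip: distrib_right of_int_add single_add)
  have B_skew: "?B x y = - ?B y x" for x y
    unfolding B_eq[OF finite_keys finite_keys order_refl order_refl]
    by (subst sum.swap) (subst t_skew, simp add: sum_negf)
  have B_0: "?B 0 y = 0" "?B x 0 = 0" for x y
    by (metis B_k zero_prod_def)+
  have t_split: "t m n a b = affine_elem (br a b) (m + n) + (0, if m + n = 0 then of_int m * form a b else 0)"
    for m n a b by (simp add: t_def affine_elem_def)
  have jac_el: "?B (affine_elem a m) (?B (affine_elem b n) (affine_elem c p)) +
      ?B (affine_elem b n) (?B (affine_elem c p) (affine_elem a m)) +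
      ?B (affine_elem c p) (?B (affine_elem a m) (affine_elem b n)) = 0" for a b c m n p
  proof -
    have f1: "form b (br c a) = form a (br b c)" 
      using G.form_invariant[of a b c] G.form_invariant[of b c a] G.form_symmetric by metis
    have f2: "form c (br a b) = form a (br b c)" 
      using G.form_invariant[of a b c] G.form_symmetric by metis
    have "t m (n + p) a (br b c) + t n (p + m) b (br c a) + t p (m + n) c (br a b) = 0"
    proof (rule prod_eqI)
      have e: "n + (p + m) = m + (n + p)" "p + (m + n) = m + (n + p)" by auto
      show "fst (t m (n + p) a (br b c) + t n (p + m) b (br c a) + t p (m + n) c (br a b)) = fst 0"
        by (simp add: t_def e G.jacobi flip: single_add)
      show "snd (t m (n + p) a (br b c) + t n (p + m) b (br c a) + t p (m + n) c (br a b)) = snd 0"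
        by (simp add: t_def e f1 f2 add.commute flip: distrib_right of_int_add)
    qed
    then show ?thesis
      unfolding B_el unfolding t_split[of n] t_split[of p] t_split[of m] B_addr B_k B_el
      by (simp add: t_split)
  qed
  have jac: "?B x (?B y z) + ?B y (?B z x) + ?B z (?B x y) = 0" for x y z
  proof (induction x arbitrary: y z rule: affine_induct)
    case (elem a m)
    show ?case
    proof (induction y arbitrary: z rule: affine_induct)
      case (elem b n)
      show ?case
      proof (induction z rule: affine_induct)
        case (elem c p)
        show ?case by (rule jac_el)
      next
        case (add z z')
        from arg_cong2[of _ _ _ _ "(+)", OF add] show ?case
          by (simp add: B_addl B_addr algebra_simps)
      qed (simp add: B_k B_0)
    next
      case (add y y')
      from arg_cong2[of _ _ _ _ "(+)", OF add(1)[of z] add(2)[of z]] show ?case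
        by (simp add: B_addl B_addr algebra_simps)
    qed (simp add: B_k B_0)
  next
    case (add x x')
    from arg_cong2[of _ _ _ _ "(+)", OF add(1)[of y z] add(2)[of y z]] show ?case
      by (simp add: B_addl B_addr algebra_simps)
  qed (simp add: B_k B_0)
  show "lie_algebra (affine_scale sg) ?B"
  proof (intro lie_algebra.intro lie_algebra_axioms.intro)
    show "vector_space (affine_scale sg)" by (rule V)
    show "Vector_Spaces.linear (affine_scale sg) (affine_scale sg) (?B x)" for x
      using V by (simp add: Vector_Spaces.linear_iff B_addr B_scr)
    show "Vector_Spaces.linear (affine_scale sg) (affine_scale sg) (\<lambda>x. ?B x y)" for y
      using V by (simp add: Vector_Spaces.linear_iff B_addl B_scl)
    show "?B x x = 0" for x
    proof -
      have "affine_scale sg (1 + 1) (?B x x) = 0"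
        using B_skew[of x x] by (simp only: V.scale_left_distrib V.scale_one eq_neg_iff_add_eq_0)
      then show ?thesis by (simp add: V.scale_eq_0_iff)
    qed
    show "?B x (?B y z) + ?B y (?B z x) + ?B z (?B x y) = 0" for x y z by (rule jac)
  qed
  show "?B (affine_elem a m) (affine_elem b n) = affine_elem (br a b) (m + n) +
      (if m + n = 0 then affine_scale sg (of_int m * form a b) affine_k else 0)"
    unfolding B_el using map_0
    by (simp add: t_def affine_elem_def affine_scale_def prod_scale_def affine_k_def zero_prod_def)
  show "?B affine_k x = 0" by (simp add: affine_k_def B_k)
qed


section \<open>Formal series\<close>

text \<open>
  A two-sided series \<open>\<Sum> w\<^sub>n x\<^sup>n\<close> is represented by its coefficient function \<open>n \<mapsto> w\<^sub>n\<close>; in particular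
  the coefficient of \<open>x\<^sup>n\<close> in \<open>a(x)\<close> is \<open>a \<otimes> t\<^bsup>-n-1\<^esup>\<close>.
\<close>

definition affine_series :: "'g::ab_group_add \<Rightarrow> int \<Rightarrow> 'g affine" where
  "affine_series a n = affine_elem a (- n - 1)"

definition lower_truncated :: "(int \<Rightarrow> 'w::zero) \<Rightarrow> bool" where
  "lower_truncated v \<longleftrightarrow> (\<exists>N. \<forall>n<N. v n = 0)"

definition poly_times ::
    "(complex \<Rightarrow> 'w::ab_group_add \<Rightarrow> 'w) \<Rightarrow> complex poly \<Rightarrow> (int \<Rightarrow> 'w) \<Rightarrow> int \<Rightarrow> 'w" where
  "poly_times s p v n = (\<Sum>i\<le>degree p. s (coeff p i) (v (n - int i)))"

text \<open>
  The action of \<open>\<complex>((x))\<close> on \<open>W((x))\<close>: for lower truncated \<open>v\<close> the index set of the sum is finite.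
\<close>

definition laurent_times ::
    "(complex \<Rightarrow> 'w::ab_group_add \<Rightarrow> 'w) \<Rightarrow> complex fls \<Rightarrow> (int \<Rightarrow> 'w) \<Rightarrow> int \<Rightarrow> 'w" where
  "laurent_times s h v n =
     (\<Sum>k | fls_nth h k \<noteq> 0 \<and> v (n - k) \<noteq> 0. s (fls_nth h k) (v (n - k)))"

text \<open>
  Laurent expansion at 0 of a rational function, as a quotient in the field \<open>\<complex>((x))\<close>.
\<close>

definition iota_0 :: "complex poly fract \<Rightarrow> complex fls" where
  "iota_0 r = (case quot_of_fract r of
     (p, q) \<Rightarrow> fps_to_fls (fps_of_poly p) / fps_to_fls (fps_of_poly q))"


section \<open>The categories R, E and C\<close>

abbreviation affine_module ::
    "(complex \<Rightarrow> 'g::ab_group_add \<Rightarrow> 'g) \<Rightarrow> ('g \<Rightarrow> 'g \<Rightarrow> 'g) \<Rightarrow> ('g \<Rightarrow> 'g \<Rightarrow> complex) \<Rightarrow>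
     (complex \<Rightarrow> 'w::ab_group_add \<Rightarrow> 'w) \<Rightarrow> ('g affine \<Rightarrow> 'w \<Rightarrow> 'w) \<Rightarrow> bool" where
  "affine_module sg br form sW \<pi> \<equiv>
     lie_module (affine_scale sg) (affine_bracket br form) sW \<pi>"

definition category_R ::
    "(complex \<Rightarrow> 'g::ab_group_add \<Rightarrow> 'g) \<Rightarrow> ('g \<Rightarrow> 'g \<Rightarrow> 'g) \<Rightarrow> ('g \<Rightarrow> 'g \<Rightarrow> complex) \<Rightarrow>
     (complex \<Rightarrow> 'w::ab_group_add \<Rightarrow> 'w) \<Rightarrow> ('g affine \<Rightarrow> 'w \<Rightarrow> 'w) \<Rightarrow> bool" where
  "category_R sg br form sW \<pi> \<longleftrightarrow> affine_module sg br form sW \<pi> \<and>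
     (\<forall>a w. lower_truncated (\<lambda>n. \<pi> (affine_series a n) w))"

definition category_E ::
    "(complex \<Rightarrow> 'g::ab_group_add \<Rightarrow> 'g) \<Rightarrow> ('g \<Rightarrow> 'g \<Rightarrow> 'g) \<Rightarrow> ('g \<Rightarrow> 'g \<Rightarrow> complex) \<Rightarrow>
     (complex \<Rightarrow> 'w::ab_group_add \<Rightarrow> 'w) \<Rightarrow> ('g affine \<Rightarrow> 'w \<Rightarrow> 'w) \<Rightarrow> bool" where
  "category_E sg br form sW \<pi> \<longleftrightarrow> affine_module sg br form sW \<pi> \<and>
     (\<exists>p. p \<noteq> 0 \<and> (\<forall>a w. poly_times sW p (\<lambda>n. \<pi> (affine_series a n) w) = (\<lambda>n. 0)))"

definition category_C ::
    "(complex \<Rightarrow> 'g::ab_group_add \<Rightarrow> 'g) \<Rightarrow> ('g \<Rightarrow> 'g \<Rightarrow> 'g) \<Rightarrow> ('g \<Rightarrow> 'g \<Rightarrow> complex) \<Rightarrow>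
     (complex \<Rightarrow> 'w::ab_group_add \<Rightarrow> 'w) \<Rightarrow> ('g affine \<Rightarrow> 'w \<Rightarrow> 'w) \<Rightarrow> bool" where
  "category_C sg br form sW \<pi> \<longleftrightarrow> affine_module sg br form sW \<pi> \<and>
     (\<exists>p. p \<noteq> 0 \<and> (\<forall>a w. lower_truncated (poly_times sW p (\<lambda>n. \<pi> (affine_series a n) w))))"


section \<open>The maps psi and the representations built from them\<close>

definition hom_laurent ::
    "(complex \<Rightarrow> 'w::ab_group_add \<Rightarrow> 'w) \<Rightarrow> (int \<Rightarrow> 'w \<Rightarrow> 'w) set" where
  "hom_laurent s =
     {b. (\<forall>n. Vector_Spaces.linear s s (b n)) \<and> (\<forall>w. lower_truncated (\<lambda>n. b n w))}"

definition poly_times_op ::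
    "(complex \<Rightarrow> 'w::ab_group_add \<Rightarrow> 'w) \<Rightarrow> complex poly \<Rightarrow> (int \<Rightarrow> 'w \<Rightarrow> 'w) \<Rightarrow> int \<Rightarrow> 'w \<Rightarrow> 'w" where
  "poly_times_op s f b n w = poly_times s f (\<lambda>m. b m w) n"

definition ebar :: "(complex \<Rightarrow> 'w::ab_group_add \<Rightarrow> 'w) \<Rightarrow> (int \<Rightarrow> 'w \<Rightarrow> 'w) set" where
  "ebar s =
     {b. (\<forall>n. Vector_Spaces.linear s s (b n)) \<and>
         (\<exists>f. f \<noteq> 0 \<and> poly_times_op s f b \<in> hom_laurent s)}"

text \<open>
  Only meaningful on \<^term>\<open>ebar s\<close>; the result does not depend on the chosen polynomial, see
  \<open>psi_R_eq\<close> below.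
\<close>

definition psi_R ::
    "(complex \<Rightarrow> 'w::ab_group_add \<Rightarrow> 'w) \<Rightarrow> (int \<Rightarrow> 'w \<Rightarrow> 'w) \<Rightarrow> int \<Rightarrow> 'w \<Rightarrow> 'w" where
  "psi_R s b n w =
     (let f = (SOME f. f \<noteq> 0 \<and> poly_times_op s f b \<in> hom_laurent s)
      in laurent_times s (iota_0 (inverse (to_fract f))) (\<lambda>m. poly_times_op s f b m w) n)"

definition psi_E ::
    "(complex \<Rightarrow> 'w::ab_group_add \<Rightarrow> 'w) \<Rightarrow> (int \<Rightarrow> 'w \<Rightarrow> 'w) \<Rightarrow> int \<Rightarrow> 'w \<Rightarrow> 'w" where
  "psi_E s b n w = b n w - psi_R s b n w"

text \<open>
  The operator of \<open>a \<otimes> t\<^sup>n\<close> is the coefficient of \<open>x\<^bsup>-n-1\<^esup>\<close>; a general element is the sum of its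
  homogeneous components and a multiple of the central element.
\<close>

definition pi_R ::
    "(complex \<Rightarrow> 'w::ab_group_add \<Rightarrow> 'w) \<Rightarrow> ('g::ab_group_add affine \<Rightarrow> 'w \<Rightarrow> 'w) \<Rightarrow>
     'g affine \<Rightarrow> 'w \<Rightarrow> 'w" where
  "pi_R s \<pi> u w =
     (\<Sum>n\<in>Poly_Mapping.keys (fst u).
        psi_R s (\<lambda>m. \<pi> (affine_series (Poly_Mapping.lookup (fst u) n) m)) (- n - 1) w)
     + s (snd u) (\<pi> affine_k w)"

definition pi_E ::
    "(complex \<Rightarrow> 'w::ab_group_add \<Rightarrow> 'w) \<Rightarrow> ('g::ab_group_add affine \<Rightarrow> 'w \<Rightarrow> 'w) \<Rightarrow>
     'g affine \<Rightarrow> 'w \<Rightarrow> 'w" where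
  "pi_E s \<pi> u w =
     (\<Sum>n\<in>Poly_Mapping.keys (fst u).
        psi_E s (\<lambda>m. \<pi> (affine_series (Poly_Mapping.lookup (fst u) n) m)) (- n - 1) w)"


section \<open>Well-definedness and generating-function form\<close>

lemma iota_0_Fract:
  assumes "q \<noteq> 0"
  shows "iota_0 (Fract p q) = fps_to_fls (fps_of_poly p) / fps_to_fls (fps_of_poly q)"
proof -
  obtain a b where ab: "quot_of_fract (Fract p q) = (a, b)" by fastforce
  have b: "b \<noteq> 0" using snd_quot_of_fract_nonzero[of "Fract p q"] ab by simp
  have "Fract a b = Fract p q" using Fract_quot_of_fract[of "Fract p q"] ab by simp
  then have "a * q = p * b" using assms b by (simp add: eq_fract)
  then have "fps_to_fls (fps_of_poly a) * fps_to_fls (fps_of_poly q)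
      = fps_to_fls (fps_of_poly p) * fps_to_fls (fps_of_poly b)"
    by (metis fls_times_fps_to_fls fps_of_poly_mult)
  then show ?thesis using assms b by (simp add: iota_0_def ab frac_eq_eq)
qed

lemma iota_0_to_fract: "iota_0 (to_fract p) = fps_to_fls (fps_of_poly p)"
  by (simp add: to_fract_def iota_0_Fract)

lemma iota_0_inverse:
  assumes "f \<noteq> 0"
  shows "iota_0 (inverse (to_fract f)) = inverse (fps_to_fls (fps_of_poly f))"
proof -
  have "inverse (to_fract f) = Fract 1 f" by (simp add: to_fract_def)
  then have "iota_0 (inverse (to_fract f)) = fps_to_fls (fps_of_poly 1) / fps_to_fls (fps_of_poly f)"
    using iota_0_Fract[OF assms, of 1] by metis
  then show ?thesis by (simp only: fps_of_poly_1 fps_one_to_fls inverse_eq_divide)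
qed


lemma laurent_times_eq_sum:
  assumes "vector_space s" "finite S"
    "\<And>k. fls_nth h k \<noteq> 0 \<Longrightarrow> v (n - k) \<noteq> 0 \<Longrightarrow> k \<in> S"
  shows "laurent_times s h v n = (\<Sum>k\<in>S. s (fls_nth h k) (v (n - k)))"
proof -
  interpret vector_space s by fact
  show ?thesis
    unfolding laurent_times_def using assms(2,3) by (intro sum.mono_neutral_left) auto
qed

lemma fls_mult_nth_eq_sum:
  fixes h k :: "complex fls"
  assumes "finite S" "\<And>i. fls_nth h i \<noteq> 0 \<Longrightarrow> fls_nth k (n - i) \<noteq> 0 \<Longrightarrow> i \<in> S"
  shows "fls_nth (h * k) n = (\<Sum>i\<in>S. fls_nth h i * fls_nth k (n - i))"
proof -
  have "fls_nth (h * k) n =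
      (\<Sum>i=fls_subdegree h..n - fls_subdegree k. fls_nth h i * fls_nth k (n - i))"
    by (simp add: fls_times_nth(2))
  also have "\<dots> = (\<Sum>i\<in>S \<union> {fls_subdegree h..n - fls_subdegree k}. fls_nth h i * fls_nth k (n - i))"
    using assms(1) by (intro sum.mono_neutral_left) (auto simp: not_le)
  also have "\<dots> = (\<Sum>i\<in>S. fls_nth h i * fls_nth k (n - i))"
    using assms by (intro sum.mono_neutral_right) auto
  finally show ?thesis .
qed

lemma laurent_times_truncated:
  assumes "vector_space s" "lower_truncated v"
  shows "lower_truncated (laurent_times s h v)"
proof -
  interpret vector_space s by fact
  obtain N where N: "v n = 0" if "n < N" for n
    using assms(2) by (auto simp: lower_truncated_def)
  have "laurent_times s h v n = 0" if "n < N + fls_subdegree h" for n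
  proof -
    have "v (n - k) = 0" if "fls_nth h k \<noteq> 0" for k
      using fls_subdegree_leI[OF that] \<open>n < N + fls_subdegree h\<close> by (intro N) auto
    then show ?thesis by (simp add: laurent_times_def)
  qed
  then show ?thesis by (auto simp: lower_truncated_def)
qed

lemma laurent_times_assoc:
  assumes "vector_space s" "lower_truncated v"
  shows "laurent_times s (h * k) v = laurent_times s h (laurent_times s k v)"
proof
  fix n
  interpret vector_space s by fact
  obtain C where C0: "v n = 0" if "n < C" for n
    using assms(2) by (auto simp: lower_truncated_def)
  then have C: "C \<le> n" if "v n \<noteq> 0" for n using that by (meson not_le)
  define A where "A = fls_subdegree h"
  define B where "B = fls_subdegree k"
  have A: "A \<le> i" if "fls_nth h i \<noteq> 0" for i
    using fls_subdegree_leI[OF that] by (simp add: A_def)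
  have B: "B \<le> i" if "fls_nth k i \<noteq> 0" for i
    using fls_subdegree_leI[OF that] by (simp add: B_def)
  have AB: "A + B \<le> i" if "fls_nth (h * k) i \<noteq> 0" for i
  proof (rule ccontr)
    assume "\<not> A + B \<le> i"
    then have "i \<in> {}" if "fls_nth h j \<noteq> 0" "fls_nth k (i - j) \<noteq> 0" for j
      using A[OF that(1)] B[OF that(2)] by auto
    then have "fls_nth (h * k) i = 0" by (subst fls_mult_nth_eq_sum[of "{}"]) auto
    with that show False by simp
  qed
  have "laurent_times s (h * k) v n =
      (\<Sum>p\<in>{A + B..n - C}. s (fls_nth (h * k) p) (v (n - p)))"
    proof (rule laurent_times_eq_sum[OF assms(1)])
    fix p assume "fls_nth (h * k) p \<noteq> 0" "v (n - p) \<noteq> 0"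
    then show "p \<in> {A + B..n - C}" using AB[of p] C[of "n - p"] by simp
  qed simp
  also have "\<dots> = (\<Sum>p\<in>{A + B..n - C}. \<Sum>i\<in>{A..p - B}.
      s (fls_nth h i * fls_nth k (p - i)) (v (n - p)))"
  proof (rule sum.cong[OF refl])
    fix p
    have "fls_nth (h * k) p = (\<Sum>i\<in>{A..p - B}. fls_nth h i * fls_nth k (p - i))"
      proof (rule fls_mult_nth_eq_sum)
      fix i assume "fls_nth h i \<noteq> 0" "fls_nth k (p - i) \<noteq> 0"
      then show "i \<in> {A..p - B}" using A[of i] B[of "p - i"] by simp
    qed simp
    then show "s (fls_nth (h * k) p) (v (n - p)) =
        (\<Sum>i\<in>{A..p - B}. s (fls_nth h i * fls_nth k (p - i)) (v (n - p)))"
      by (simp add: scale_sum_left)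
  qed
  also have "\<dots> = (\<Sum>(p, i)\<in>Sigma {A + B..n - C} (\<lambda>p. {A..p - B}).
      s (fls_nth h i * fls_nth k (p - i)) (v (n - p)))"
    by (rule sum.Sigma) auto
  also have "\<dots> = (\<Sum>(i, j)\<in>Sigma {A..n - B - C} (\<lambda>i. {B..n - i - C}).
      s (fls_nth h i * fls_nth k j) (v (n - i - j)))"
    by (rule sum.reindex_bij_witness[of _ "\<lambda>(i, j). (i + j, i)" "\<lambda>(p, i). (i, p - i)"])
      (auto simp: diff_diff_eq)
  also have "\<dots> = (\<Sum>i\<in>{A..n - B - C}. \<Sum>j\<in>{B..n - i - C}.
      s (fls_nth h i * fls_nth k j) (v (n - i - j)))"
    by (rule sum.Sigma[symmetric]) auto
  also have "\<dots> = (\<Sum>i\<in>{A..n - B - C}. s (fls_nth h i) (laurent_times s k v (n - i)))"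
  proof (rule sum.cong[OF refl])
    fix i
    have "laurent_times s k v (n - i) = (\<Sum>j\<in>{B..n - i - C}. s (fls_nth k j) (v (n - i - j)))"
      proof (rule laurent_times_eq_sum[OF assms(1)])
      fix j assume "fls_nth k j \<noteq> 0" "v (n - i - j) \<noteq> 0"
      then show "j \<in> {B..n - i - C}" using B[of j] C[of "n - i - j"] by simp
    qed simp
    then show "(\<Sum>j\<in>{B..n - i - C}. s (fls_nth h i * fls_nth k j) (v (n - i - j)))
        = s (fls_nth h i) (laurent_times s k v (n - i))"
      by (simp add: scale_sum_right)
  qed
  also have "\<dots> = laurent_times s h (laurent_times s k v) n"
  proof (rule laurent_times_eq_sum[symmetric])
    fix i assume i: "fls_nth h i \<noteq> 0" "laurent_times s k v (n - i) \<noteq> 0"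
    have "{j. fls_nth k j \<noteq> 0 \<and> v (n - i - j) \<noteq> 0} \<noteq> {}"
      using i(2) unfolding laurent_times_def by (metis (no_types) sum.empty)
    then obtain j where j: "fls_nth k j \<noteq> 0" "v (n - i - j) \<noteq> 0" by blast
    show "i \<in> {A..n - B - C}"
      using A[OF i(1)] B[OF j(1)] C[OF j(2)] by auto
  qed (use assms in auto)
  finally show "laurent_times s (h * k) v n = laurent_times s h (laurent_times s k v) n" .
qed

lemma laurent_times_poly:
  assumes "vector_space s"
  shows "laurent_times s (fps_to_fls (fps_of_poly f)) v = poly_times s f v"
proof
  fix n
  have "laurent_times s (fps_to_fls (fps_of_poly f)) v n =
      (\<Sum>k\<in>int ` {..degree f}. s (fls_nth (fps_to_fls (fps_of_poly f)) k) (v (n - k)))"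
  proof (rule laurent_times_eq_sum[OF assms])
    fix k assume "fls_nth (fps_to_fls (fps_of_poly f)) k \<noteq> 0"
    then have "0 \<le> k" "coeff f (nat k) \<noteq> 0" by (auto split: if_splits)
    then show "k \<in> int ` {..degree f}"
      by (intro image_eqI[of _ _ "nat k"]) (auto intro: le_degree)
  qed auto
  also have "\<dots> = poly_times s f v n"
    by (simp add: poly_times_def sum.reindex inj_on_def)
  finally show "laurent_times s (fps_to_fls (fps_of_poly f)) v n = poly_times s f v n" .
qed

lemma laurent_times_1:
  assumes "vector_space s"
  shows "laurent_times s 1 v = v"
proof -
  interpret vector_space s by fact
  show ?thesis
    by (rule ext, subst laurent_times_eq_sum[OF assms, of "{0}"]) (auto split: if_splits)
qed

lemma poly_times_comm:
  assumes "vector_space s"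
  shows "poly_times s f (poly_times s g v) = poly_times s g (poly_times s f v)"
proof
  fix n
  interpret vector_space s by fact
  have "poly_times s f (poly_times s g v) n = (\<Sum>i\<le>degree f. \<Sum>j\<le>degree g.
      s (coeff f i) (s (coeff g j) (v (n - int i - int j))))"
    by (simp add: poly_times_def scale_sum_right)
  also have "\<dots> = (\<Sum>j\<le>degree g. \<Sum>i\<le>degree f.
      s (coeff g j) (s (coeff f i) (v (n - int j - int i))))"
    by (subst sum.swap) (simp add: mult.commute diff_diff_eq add.commute)
  also have "\<dots> = poly_times s g (poly_times s f v) n"
    by (simp add: poly_times_def scale_sum_right)
  finally show "poly_times s f (poly_times s g v) n = poly_times s g (poly_times s f v) n" .
qed

lemma psi_R_eq:
  assumes s: "vector_space s" and f: "f \<noteq> 0" "poly_times_op s f b \<in> hom_laurent s"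
  shows "psi_R s b n w =
    laurent_times s (iota_0 (inverse (to_fract f))) (\<lambda>m. poly_times_op s f b m w) n"
proof -
  define g where "g = (SOME f. f \<noteq> 0 \<and> poly_times_op s f b \<in> hom_laurent s)"
  have g: "g \<noteq> 0" "poly_times_op s g b \<in> hom_laurent s"
    using someI[of "\<lambda>f. f \<noteq> 0 \<and> poly_times_op s f b \<in> hom_laurent s" f] f by (auto simp: g_def)
  define F where "F = (\<lambda>p. fps_to_fls (fps_of_poly p) :: complex fls)"
  define v where "v = (\<lambda>m. b m w)"
  have F0: "F p \<noteq> 0" if "p \<noteq> 0" for p using that by (simp add: F_def)
  have tf: "lower_truncated (poly_times s f v)" and tg: "lower_truncated (poly_times s g v)"
    using f(2) g(2) by (auto simp: hom_laurent_def poly_times_op_def v_def)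
  have e: "inverse (F f * F g) * F g = inverse (F f)" "inverse (F f * F g) * F f = inverse (F g)"
    using F0[OF f(1)] F0[OF g(1)] by (simp_all add: field_simps)
  have L: "laurent_times s (inverse (F f)) (poly_times s f v) =
      laurent_times s (inverse (F f * F g)) (laurent_times s (F g) (poly_times s f v))"
    unfolding laurent_times_assoc[OF s tf, symmetric] e ..
  have R: "laurent_times s (inverse (F g)) (poly_times s g v) =
      laurent_times s (inverse (F f * F g)) (laurent_times s (F f) (poly_times s g v))"
    unfolding laurent_times_assoc[OF s tg, symmetric] e ..
  have "laurent_times s (inverse (F f)) (poly_times s f v) =
      laurent_times s (inverse (F g)) (poly_times s g v)"
    unfolding L R by (simp add: F_def laurent_times_poly[OF s] poly_times_comm[OF s, of f g])
  then show ?thesis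
    by (simp add: psi_R_def Let_def iota_0_inverse f(1) g(1) poly_times_op_def F_def v_def
        flip: g_def)
qed

lemma psi_R_zero: "vector_space s \<Longrightarrow> psi_R s (\<lambda>n w. 0) n w = 0"
proof -
  assume s: "vector_space s"
  interpret vector_space s by fact
  show ?thesis by (simp add: psi_R_def laurent_times_def poly_times_op_def poly_times_def)
qed

lemma (in lie_module) rep_zero: "\<rho> 0 w = 0"
  using rep_add[of 0 0 w] by simp

lemma
  assumes "affine_module sg br form sW \<pi>"
  shows pi_R_affine_series:
      "pi_R sW \<pi> (affine_series a n) = psi_R sW (\<lambda>m. \<pi> (affine_series a m)) n"
    and pi_R_k: "pi_R sW \<pi> affine_k = \<pi> affine_k"
    and pi_E_affine_series:
      "pi_E sW \<pi> (affine_series a n) = psi_E sW (\<lambda>m. \<pi> (affine_series a m)) n"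
    and pi_E_k: "pi_E sW \<pi> affine_k = (\<lambda>w. 0)"
proof -
  interpret lie_module "affine_scale sg" "affine_bracket br form" sW \<pi> by fact
  have z: "\<pi> (affine_series 0 m) = (\<lambda>w. 0)" for m
    using rep_zero by (auto simp: affine_series_def affine_elem_def zero_prod_def)
  have ser: "fst (affine_series a n) = Poly_Mapping.single (- n - 1) a" "snd (affine_series a n) = 0"
    for a :: 'a and n
    by (simp_all add: affine_series_def affine_elem_def)
  have R0: "psi_R sW (\<lambda>m. \<pi> (affine_series 0 m)) n w = 0" for n w
    by (simp add: z psi_R_zero W.vector_space_axioms)
  have E0: "psi_E sW (\<lambda>m. \<pi> (affine_series 0 m)) n w = 0" for n w
    using R0 by (simp add: psi_E_def z)
  show "pi_R sW \<pi> (affine_series a n) = psi_R sW (\<lambda>m. \<pi> (affine_series a m)) n"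
    by (cases "a = 0") (auto simp: pi_R_def ser fun_eq_iff R0)
  show "pi_E sW \<pi> (affine_series a n) = psi_E sW (\<lambda>m. \<pi> (affine_series a m)) n"
    by (cases "a = 0") (auto simp: pi_E_def ser fun_eq_iff E0)
qed (auto simp: pi_R_def pi_E_def affine_k_def lie_module_def vector_space.vector_space_assms[OF
      lie_module.axioms(2)[OF assms]])

lemma category_C_imp_ebar:
  assumes "category_C sg br form sW \<pi>"
  shows "(\<lambda>m. \<pi> (affine_series a m)) \<in> ebar sW"
proof -
  interpret lie_module "affine_scale sg" "affine_bracket br form" sW \<pi>
    using assms by (simp add: category_C_def)
  note lin = Vector_Spaces.linear_iff[THEN iffD1, OF operator_linear]
  obtain p where p: "p \<noteq> 0"
      "\<And>w. lower_truncated (poly_times sW p (\<lambda>n. \<pi> (affine_series a n) w))"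
    using assms by (auto simp: category_C_def)
  have "Vector_Spaces.linear sW sW (poly_times_op sW p (\<lambda>m. \<pi> (affine_series a m)) n)" for n
    using lin by (simp add: Vector_Spaces.linear_iff poly_times_op_def poly_times_def
        W.scale_right_distrib sum.distrib W.scale_sum_right W.scale_left_commute mult.commute)
  then have "poly_times_op sW p (\<lambda>m. \<pi> (affine_series a m)) \<in> hom_laurent sW"
    using p(2) by (simp add: hom_laurent_def poly_times_op_def)
  then show ?thesis using p(1) operator_linear by (auto simp: ebar_def)
qed

end

theory Submission
  imports Defs
begin

text \<open>
  The idea is to characterise \<open>\<psi>\<^sub>R\<close> instead of computing with it.  Fix a nonzero polynomial \<open>p\<close>
  such that \<open>p(x) a(x) w\<close> is lower truncated for all \<open>a\<close> and \<open>w\<close>.  Since \<open>p\<close> is invertible in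
  \<open>\<complex>((x))\<close>, a series \<open>v\<close> with \<open>p v\<close> lower truncated has exactly one lower truncated companion
  \<open>u\<close> with \<open>p u = p v\<close>, its regular part, and \<open>\<psi>\<^sub>R(a(x))w\<close> is the regular part of \<open>a(x)w\<close>
  (\<open>psi_R_regular_part\<close>).  Regular parts are additive, they are compatible with linear operators
  acting on coefficients and with multiplication by powers of \<open>x\<close>, and a lower truncated series is
  its own regular part.

  Write \<open>T\<close> for a linear operator.  Taking regular parts in
  \<open>T b(x)w - b(x)Tw = [T, b(x)]w\<close> replaces \<open>b(x)\<close> by \<open>\<psi>\<^sub>R(b(x))\<close> on the left.
  \<^item> For \<open>T = \<pi>(u)\<close> the right side is \<open>\<pi>([u, b(x)])w\<close>, which by the affine commutation relations
    is, for \<open>u = a \<otimes> t\<^sup>m\<close>, the series \<open>[a,b](x)w\<close> multiplied by \<open>x\<^sup>m\<close> plus a single central term.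
    Its regular part is therefore \<open>\<pi>\<^sub>R([u, b(x)])w\<close>, whence \<open>[\<pi>(u), \<pi>\<^sub>R(v)] = \<pi>\<^sub>R([u,v])\<close>.
  \<^item> For \<open>T = \<pi>\<^sub>R(u)\<close> the right side is then \<open>\<pi>\<^sub>R([u, b(x)])w\<close>, already lower truncated, whence
    \<open>[\<pi>\<^sub>R(u), \<pi>\<^sub>R(v)] = \<pi>\<^sub>R([u,v])\<close>.

  As \<open>\<pi>\<^sub>E = \<pi> - \<pi>\<^sub>R\<close>, these two relations give by linear algebra that \<open>\<pi>\<^sub>R\<close> and \<open>\<pi>\<^sub>E\<close> commute
  and that \<open>\<pi>\<^sub>E\<close> is a representation.  The polynomial \<open>p\<close> annihilates the \<open>\<pi>\<^sub>E\<close> series because a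
  series and its regular part agree after multiplication by \<open>p\<close>.  Irreducibility passes to the
  direct sum because its diagonal acts by \<open>\<pi>\<close>.
\<close>

section \<open>Modules over direct sums of Lie algebras\<close>

lemma (in lie_algebra) bracket_add:
  "bracket (x + y) z = bracket x z + bracket y z"
  "bracket x (y + z) = bracket x y + bracket x z"
  using bracket_linear_left bracket_linear_right by (simp_all add: Vector_Spaces.linear_iff)

lemma (in lie_algebra) bracket_skew: "bracket x y = - bracket y x"
proof -
  have "bracket (x + y) (x + y) = bracket x y + bracket y x"
    by (simp only: bracket_add) (simp add: bracket_self)
  then show ?thesis by (simp add: bracket_self eq_neg_iff_add_eq_0)
qed

lemma (in lie_module) operator_add: "\<rho> u (v + w) = \<rho> u v + \<rho> u w"
  and operator_scale: "\<rho> u (scaleW c w) = scaleW c (\<rho> u w)"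
  using operator_linear by (simp_all add: Vector_Spaces.linear_iff)

lemma lie_module_of_commuting:
  assumes "lie_module s1 br1 sW \<rho>1" "lie_module s2 br2 sW \<rho>2"
    and commute: "\<And>u v w. \<rho>1 u (\<rho>2 v w) = \<rho>2 v (\<rho>1 u w)"
  shows "lie_module (prod_scale s1 s2) (prod_bracket br1 br2) sW (\<lambda>(u, v) w. \<rho>1 u w + \<rho>2 v w)"
proof -
  interpret A: lie_module s1 br1 sW \<rho>1 by fact
  interpret B: lie_module s2 br2 sW \<rho>2 by fact
  interpret P: lie_algebra "prod_scale s1 s2" "prod_bracket br1 br2"
    by (intro prod_lie_algebra A.L.lie_algebra_axioms B.L.lie_algebra_axioms)
  show ?thesis
    by unfold_locales
      (auto simp: Vector_Spaces.linear_iff A.W.vector_space_axioms A.operator_add B.operator_add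
        A.operator_scale B.operator_scale A.rep_add B.rep_add A.rep_scale B.rep_scale
        A.rep_bracket B.rep_bracket prod_scale_def prod_bracket_def commute
        A.W.scale_right_distrib algebra_simps)
qed

text \<open>More operators leave fewer subspaces invariant.\<close>

lemma irreducible_lie_module_extend:
  assumes "irreducible_lie_module sL brL sW \<rho>" "lie_module sM brM sW \<sigma>"
    and "\<And>u. \<exists>v. \<sigma> v = \<rho> u"
  shows "irreducible_lie_module sM brM sW \<sigma>"
  using assms unfolding irreducible_lie_module_def by metis


section \<open>Regular parts of formal series\<close>

text \<open>
  Stated as a relation rather than through division by \<open>p\<close>: all closure properties are then
  properties of multiplication by \<open>p\<close>, and division is only needed for existence and uniqueness.
\<close>

definition regular_part_of ::
    "(complex \<Rightarrow> 'w::ab_group_add \<Rightarrow> 'w) \<Rightarrow> complex poly \<Rightarrow> (int \<Rightarrow> 'w) \<Rightarrow> (int \<Rightarrow> 'w) \<Rightarrow> bool" where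
  "regular_part_of s p u v \<longleftrightarrow> lower_truncated u \<and> poly_times s p u = poly_times s p v"

lemma lower_truncated_add:
  fixes u v :: "int \<Rightarrow> 'w::monoid_add"
  assumes "lower_truncated u" "lower_truncated v"
  shows "lower_truncated (\<lambda>n. u n + v n)"
proof -
  obtain M N where "\<And>n. n < M \<Longrightarrow> u n = 0" "\<And>n. n < N \<Longrightarrow> v n = 0"
    using assms unfolding lower_truncated_def by blast
  then have "\<forall>n < min M N. u n + v n = 0" by simp
  then show ?thesis unfolding lower_truncated_def by blast
qed

lemma lower_truncated_map:
  "lower_truncated v \<Longrightarrow> T 0 = 0 \<Longrightarrow> lower_truncated (\<lambda>n. T (v n))"
  unfolding lower_truncated_def by force

lemma lower_truncated_shift:
  assumes "lower_truncated v"
  shows "lower_truncated (\<lambda>n. v (n - m))"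
proof -
  obtain N where "\<And>n. n < N \<Longrightarrow> v n = 0" using assms unfolding lower_truncated_def by blast
  then have "\<forall>n < N + m. v (n - m) = 0" by simp
  then show ?thesis unfolding lower_truncated_def by blast
qed

locale complex_vector_space = vector_space scale
  for scale :: "complex \<Rightarrow> 'w::ab_group_add \<Rightarrow> 'w"
begin

lemma poly_times_add: "poly_times scale p (\<lambda>n. u n + v n) n = poly_times scale p u n + poly_times scale p v n"
  by (simp add: poly_times_def scale_right_distrib sum.distrib)

lemma poly_times_map:
  assumes "Vector_Spaces.linear scale scale T"
  shows "poly_times scale p (\<lambda>n. T (v n)) n = T (poly_times scale p v n)"
proof -
  interpret T: Vector_Spaces.linear scale scale T by fact
  show ?thesis by (simp add: poly_times_def T.sum T.scale)
qed

lemma poly_times_shift: "poly_times scale p (\<lambda>n. v (n - m)) n = poly_times scale p v (n - m)"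
  by (simp add: poly_times_def algebra_simps)

lemma regular_part_refl: "lower_truncated u \<Longrightarrow> regular_part_of scale p u u"
  by (simp add: regular_part_of_def)

lemma regular_part_add:
  assumes "regular_part_of scale p u v" "regular_part_of scale p u' v'"
  shows "regular_part_of scale p (\<lambda>n. u n + u' n) (\<lambda>n. v n + v' n)"
  using assms by (auto simp: regular_part_of_def lower_truncated_add poly_times_add)

lemma regular_part_map:
  assumes "Vector_Spaces.linear scale scale T" "regular_part_of scale p u v"
  shows "regular_part_of scale p (\<lambda>n. T (u n)) (\<lambda>n. T (v n))"
proof -
  interpret T: Vector_Spaces.linear scale scale T by fact
  show ?thesis
    using assms lower_truncated_map[of u T] by (simp add: regular_part_of_def poly_times_map fun_eq_iff)
qed

lemma regular_part_diff:
  assumes "regular_part_of scale p u v" "regular_part_of scale p u' v'"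
  shows "regular_part_of scale p (\<lambda>n. u n - u' n) (\<lambda>n. v n - v' n)"
proof -
  have "Vector_Spaces.linear scale scale uminus"
    by (simp add: Vector_Spaces.linear_iff vector_space_axioms)
  from regular_part_add[OF assms(1) regular_part_map[OF this assms(2)]] show ?thesis by simp
qed

lemma regular_part_shift:
  assumes "regular_part_of scale p u v"
  shows "regular_part_of scale p (\<lambda>n. u (n - m)) (\<lambda>n. v (n - m))"
  using assms by (auto simp: regular_part_of_def poly_times_shift lower_truncated_shift)

text \<open>
  On lower truncated series multiplication by \<open>p\<close> can be undone by the inverse of \<open>p\<close> in
  \<open>\<complex>((x))\<close>; on arbitrary two-sided series it has a kernel.
\<close>

lemma regular_part_unique:
  assumes "p \<noteq> 0" "regular_part_of scale p u v" "regular_part_of scale p u' v"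
  shows "u = u'"
proof -
  define P where "P = (fps_to_fls (fps_of_poly p) :: complex fls)"
  have "P \<noteq> 0" using assms(1) by (simp add: P_def)
  then have inv: "u = laurent_times scale (inverse P) (poly_times scale p u)"
    if "lower_truncated u" for u
    using laurent_times_assoc[OF vector_space_axioms that, of "inverse P" P]
    by (simp add: P_def laurent_times_poly laurent_times_1 vector_space_axioms)
  show ?thesis
    using inv[of u] inv[of u'] assms(2,3) unfolding regular_part_of_def by simp
qed

lemma psi_R_regular_part:
  assumes "p \<noteq> 0" "poly_times_op scale p b \<in> hom_laurent scale"
  shows "regular_part_of scale p (\<lambda>n. psi_R scale b n w) (\<lambda>n. b n w)"
proof -
  define P where "P = (fps_to_fls (fps_of_poly p) :: complex fls)"
  define v where "v = poly_times scale p (\<lambda>n. b n w)"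
  have P: "P \<noteq> 0" using assms(1) by (simp add: P_def)
  have v: "lower_truncated v"
    using assms(2) by (simp add: v_def hom_laurent_def poly_times_op_def)
  have psi: "(\<lambda>n. psi_R scale b n w) = laurent_times scale (inverse P) v"
    by (simp add: fun_eq_iff psi_R_eq[OF vector_space_axioms assms] iota_0_inverse assms(1)
        P_def v_def poly_times_op_def)
  have "poly_times scale p (laurent_times scale (inverse P) v) = laurent_times scale (P * inverse P) v"
    by (simp add: laurent_times_assoc vector_space_axioms v P_def laurent_times_poly)
  also have "\<dots> = v" using P by (simp add: laurent_times_1 vector_space_axioms)
  finally show ?thesis
    using laurent_times_truncated[OF vector_space_axioms v]
    by (simp add: regular_part_of_def psi v_def)
qed

end


section \<open>The regular part of a module in the category C\<close>

text \<open>
  The polynomial is a parameter because it is uniform in \<open>a\<close> and \<open>w\<close>: the closure properties of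
  \<open>regular_part_of\<close> combine series taken with one common \<open>p\<close>, and membership in the category E asks
  for one \<open>p\<close> annihilating all \<open>\<pi>\<^sub>E\<close> series.
\<close>

locale category_C_module = lie_algebra_with_form sg br form
  for sg :: "complex \<Rightarrow> 'g::ab_group_add \<Rightarrow> 'g" and br and form +
  fixes sW :: "complex \<Rightarrow> 'w::ab_group_add \<Rightarrow> 'w"
    and \<pi> :: "'g affine \<Rightarrow> 'w \<Rightarrow> 'w"
    and p :: "complex poly"
  assumes affine_module: "affine_module sg br form sW \<pi>"
    and p_nonzero: "p \<noteq> 0"
    and p_truncates: "\<And>a w. lower_truncated (poly_times sW p (\<lambda>n. \<pi> (affine_series a n) w))"
begin

sublocale lie_module "affine_scale sg" "affine_bracket br form" sW \<pi>
  by (rule affine_module)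

sublocale W: complex_vector_space sW
  by unfold_locales

abbreviation \<pi>R where "\<pi>R \<equiv> pi_R sW \<pi>"
abbreviation \<pi>E where "\<pi>E \<equiv> pi_E sW \<pi>"
abbreviation brackets ("\<lbrakk>_, _\<rbrakk>") where "\<lbrakk>u, v\<rbrakk> \<equiv> affine_bracket br form u v"
abbreviation reg where "reg \<equiv> regular_part_of sW p"

lemma affine_elem_eq_series: "affine_elem a n = affine_series a (- n - 1)"
  by (simp add: affine_series_def)

lemma affine_series_add: "affine_series (a + b) n = affine_series a n + affine_series b n"
  by (simp add: affine_series_def affine_elem_def single_add)

lemma affine_scale_series: "affine_scale sg c (affine_series a n) = affine_series (sg c a) n"
proof -
  have "Poly_Mapping.map (sg c) (Poly_Mapping.single k a) = Poly_Mapping.single k (sg c a)" for k :: int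
    by (intro poly_mapping_eqI) (auto simp: map.rep_eq lookup_single when_def)
  then show ?thesis by (simp add: affine_scale_def prod_scale_def affine_series_def affine_elem_def)
qed

lemma affine_scale_central: "affine_scale sg c (0, d) = (0, c * d)"
  by (auto simp: affine_scale_def prod_scale_def map.rep_eq intro!: poly_mapping_eqI)

lemma bracket_central: "\<lbrakk>(0, c), u\<rbrakk> = 0" "\<lbrakk>u, (0, c)\<rbrakk> = 0"
  by (simp_all add: affine_bracket_def)

lemma pi_R_series_regular: "reg (\<lambda>n. \<pi>R (affine_series a n) w) (\<lambda>n. \<pi> (affine_series a n) w)"
proof -
  have "Vector_Spaces.linear sW sW (poly_times_op sW p (\<lambda>m. \<pi> (affine_series a m)) n)" for n
    by (simp add: Vector_Spaces.linear_iff W.vector_space_axioms poly_times_op_def operator_add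
        operator_scale poly_times_def W.scale_right_distrib sum.distrib W.scale_sum_right
        mult.commute)
  then have "poly_times_op sW p (\<lambda>m. \<pi> (affine_series a m)) \<in> hom_laurent sW"
    using p_truncates by (simp add: hom_laurent_def poly_times_op_def)
  from W.psi_R_regular_part[OF p_nonzero this]
  show ?thesis by (simp add: pi_R_affine_series[OF affine_module])
qed

text \<open>
  The workhorse for identities about \<open>\<pi>\<^sub>R\<close>: any regular part of \<open>a(x)w\<close>, obtained in whatever way,
  has the operators of \<open>\<pi>\<^sub>R\<close> as coefficients.
\<close>

lemmas pi_R_series_eqI = fun_cong[OF W.regular_part_unique[OF p_nonzero pi_R_series_regular]]

lemma pi_R_series_add:
  "\<pi>R (affine_series (a + b) n) w = \<pi>R (affine_series a n) w + \<pi>R (affine_series b n) w"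
  by (rule pi_R_series_eqI)
    (simp only: affine_series_add rep_add,
      intro W.regular_part_add pi_R_series_regular)

lemma pi_R_central: "\<pi>R (0, c) w = sW c (\<pi> affine_k w)"
  by (simp add: pi_R_def)

lemma pi_central: "\<pi> (0, c) w = sW c (\<pi> affine_k w)"
  using rep_scale[of c affine_k w] by (simp add: affine_k_def affine_scale_central)

text \<open>
  The homogeneous components of \<open>u\<close> are separated so that additivity of \<open>\<pi>\<^sub>R\<close>, whose definition
  sums over a support that varies with \<open>u\<close>, reduces to additivity in each component.
\<close>

lemma pi_R_eq_sum:
  "\<pi>R u w = (\<Sum>n\<in>Poly_Mapping.keys (fst u).
      \<pi>R (affine_elem (Poly_Mapping.lookup (fst u) n) n) w) + sW (snd u) (\<pi> affine_k w)"
  by (simp add: pi_R_def[of _ _ u] affine_elem_eq_series pi_R_affine_series[OF affine_module])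

lemma pi_R_zero: "\<pi>R 0 w = 0"
  by (simp add: pi_R_def)

lemma pi_R_add: "\<pi>R (u + v) w = \<pi>R u w + \<pi>R v w"
proof -
  have "\<pi>R (affine_elem 0 n) w = 0" for n
    using pi_R_zero by (simp add: affine_elem_def zero_prod_def)
  then show ?thesis
    unfolding pi_R_eq_sum[of "u + v"] pi_R_eq_sum[of u] pi_R_eq_sum[of v] fst_add
    by (subst setsum_keys_plus_distrib[of "\<lambda>n a. \<pi>R (affine_elem a n) w"])
      (simp_all add: affine_elem_eq_series pi_R_series_add W.scale_left_distrib)
qed

lemma pi_R_scale: "\<pi>R (affine_scale sg c u) w = sW c (\<pi>R u w)"
proof (induction u rule: affine_induct)
  case (elem a n)
  have lin: "Vector_Spaces.linear sW sW (sW c)"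
    by (simp add: Vector_Spaces.linear_iff W.vector_space_axioms W.scale_right_distrib mult.commute)
  show ?case
    unfolding affine_elem_eq_series affine_scale_series
    by (rule pi_R_series_eqI)
      (simp only: rep_scale flip: affine_scale_series,
        intro W.regular_part_map[OF lin] pi_R_series_regular)
next
  case (central d)
  show ?case by (simp add: affine_scale_central pi_R_central)
next
  case (add u v)
  then show ?case by (simp add: L.scale_right_distrib pi_R_add W.scale_right_distrib)
qed

lemma pi_R_linear: "Vector_Spaces.linear sW sW (\<pi>R u)"
proof (induction u rule: affine_induct)
  case (elem a n)
  have lin: "Vector_Spaces.linear sW sW (sW c)" for c
    by (simp add: Vector_Spaces.linear_iff W.vector_space_axioms W.scale_right_distrib mult.commute)
  have "\<pi>R (affine_series a m) (v + w) = \<pi>R (affine_series a m) v + \<pi>R (affine_series a m) w" for m v w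
    by (rule pi_R_series_eqI)
      (simp only: operator_add, intro W.regular_part_add pi_R_series_regular)
  moreover have "\<pi>R (affine_series a m) (sW c w) = sW c (\<pi>R (affine_series a m) w)" for m c w
    by (rule pi_R_series_eqI)
      (simp only: operator_scale, intro W.regular_part_map[OF lin] pi_R_series_regular)
  ultimately show ?case
    by (simp add: Vector_Spaces.linear_iff W.vector_space_axioms affine_elem_eq_series)
next
  case (central c)
  show ?case
    by (simp add: Vector_Spaces.linear_iff W.vector_space_axioms pi_R_central operator_add
        operator_scale W.scale_right_distrib mult.commute)
next
  case (add u v)
  then show ?case
    by (simp add: Vector_Spaces.linear_iff pi_R_add W.scale_right_distrib algebra_simps)
qed

lemma pi_R_op_add: "\<pi>R u (v + w) = \<pi>R u v + \<pi>R u w"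
  and pi_R_op_scale: "\<pi>R u (sW c w) = sW c (\<pi>R u w)"
  using pi_R_linear by (simp_all add: Vector_Spaces.linear_iff)

text \<open>
  The coefficients of \<open>\<psi>\<^sub>R(b) + \<psi>\<^sub>E(b)\<close> are those of \<open>b\<close>, so the right side is the sum of \<open>\<pi>\<close> over
  the homogeneous components of \<open>u\<close> and its central part.
\<close>

lemma pi_decomposition: "\<pi> u w = \<pi>R u w + \<pi>E u w"
proof -
  define S where "S u = (\<Sum>n\<in>Poly_Mapping.keys (fst u).
      \<pi> (affine_elem (Poly_Mapping.lookup (fst u) n) n) w) + sW (snd u) (\<pi> affine_k w)" for u
  have z: "\<pi> (affine_elem 0 n) w = 0" for n
    using rep_zero by (simp add: affine_elem_def zero_prod_def)
  have S_add: "S (u + v) = S u + S v" for u v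
    unfolding S_def fst_add
    by (subst setsum_keys_plus_distrib[of "\<lambda>n a. \<pi> (affine_elem a n) w"])
      (simp_all add: z[unfolded affine_elem_eq_series] affine_elem_eq_series affine_series_add rep_add W.scale_left_distrib)
  have "\<pi> u w = S u"
  proof (induction u rule: affine_induct)
    case (elem a n)
    show ?case by (cases "a = 0") (simp_all add: S_def z, simp_all add: affine_elem_def)
  next
    case (central c)
    show ?case by (simp add: S_def pi_central)
  next
    case (add u v)
    then show ?case by (simp add: rep_add S_add)
  qed
  then show ?thesis
    by (simp add: S_def pi_R_def pi_E_def psi_E_def affine_elem_eq_series sum_subtractf)
qed

lemma pi_E_eq: "\<pi>E u w = \<pi> u w - \<pi>R u w"
  by (simp add: pi_decomposition)


section \<open>Commutation relations\<close>

text \<open>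
  For \<open>v = a \<otimes> t\<^sup>m\<close> the series \<open>[v, b(x)]\<close> is \<open>x\<^sup>m [a,b](x)\<close> plus one central term, and both
  summands are compatible with regular parts.
\<close>

lemma bracket_series_regular: "reg (\<lambda>n. \<pi>R \<lbrakk>v, affine_series b n\<rbrakk> w) (\<lambda>n. \<pi> \<lbrakk>v, affine_series b n\<rbrakk> w)"
proof (induction v rule: affine_induct)
  case (elem a m)
  define z where "z n = (if n = m - 1 then sW (of_int m * form a b) (\<pi> affine_k w) else 0)" for n
  have br: "\<lbrakk>affine_elem a m, affine_series b n\<rbrakk> = affine_series (br a b) (n - m) +
      (if n = m - 1 then affine_scale sg (of_int m * form a b) affine_k else 0)" for n
    unfolding affine_series_def[of b]
      affine_bracket_elem[OF lie_algebra_with_form_axioms]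
    by (auto simp: affine_series_def algebra_simps)
  have "lower_truncated z" unfolding z_def lower_truncated_def by auto
  moreover have "\<pi> \<lbrakk>affine_elem a m, affine_series b n\<rbrakk> w = \<pi> (affine_series (br a b) (n - m)) w + z n" for n
    by (simp add: br rep_add rep_scale rep_zero z_def)
  moreover have "\<pi>R \<lbrakk>affine_elem a m, affine_series b n\<rbrakk> w = \<pi>R (affine_series (br a b) (n - m)) w + z n" for n
    by (simp add: br pi_R_add pi_R_scale pi_R_zero pi_R_k[OF affine_module] z_def)
  ultimately show ?case
    by (simp only:) (intro W.regular_part_add W.regular_part_refl W.regular_part_shift[OF pi_R_series_regular])
next
  case (central c)
  show ?case by (simp add: bracket_central pi_R_zero rep_zero regular_part_of_def lower_truncated_def)
next
  case (add u v)
  from W.regular_part_add[OF add] show ?case by (simp only: L.bracket_add pi_R_add rep_add)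
qed

text \<open>
  Both sides are regular parts of the series \<open>[T, b(x)]w\<close>: the left one because \<open>T\<close> may be applied
  to regular parts coefficientwise.
\<close>

lemma commutator_pi_R_series:
  assumes T: "Vector_Spaces.linear sW sW T"
    and d: "reg d (\<lambda>n. T (\<pi> (affine_series b n) w) - \<pi> (affine_series b n) (T w))"
  shows "T (\<pi>R (affine_series b n) w) - \<pi>R (affine_series b n) (T w) = d n"
  by (rule fun_cong[OF W.regular_part_unique[OF p_nonzero _ d]])
    (intro W.regular_part_diff W.regular_part_map[OF T] pi_R_series_regular)

lemma pi_R_uminus: "\<pi>R (- u) w = - \<pi>R u w"
  using pi_R_add[of u "- u" w] by (simp add: pi_R_zero minus_unique)

lemma commutator_pi_pi_R: "\<pi> u (\<pi>R v w) - \<pi>R v (\<pi> u w) = \<pi>R \<lbrakk>u, v\<rbrakk> w"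
proof (induction v arbitrary: w rule: affine_induct)
  case (elem b n)
  show ?case
    unfolding affine_elem_eq_series
    by (rule commutator_pi_R_series[OF operator_linear,
          where d = "\<lambda>n. \<pi>R \<lbrakk>u, affine_series b n\<rbrakk> w"])
      (simp only: bracket_series_regular flip: rep_bracket)
next
  case (central c)
  show ?case
    using rep_bracket[of u "(0, c)" w]
    by (simp add: pi_R_central bracket_central rep_zero pi_R_zero flip: pi_central)
next
  case (add v v')
  from arg_cong2[of _ _ _ _ "(+)", OF add(1)[of w] add(2)[of w]] show ?case
    by (simp add: pi_R_add operator_add L.bracket_add algebra_simps)
qed

lemma commutator_pi_R_pi: "\<pi>R u (\<pi> v w) - \<pi> v (\<pi>R u w) = \<pi>R \<lbrakk>u, v\<rbrakk> w"
proof -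
  have "\<pi>R u (\<pi> v w) - \<pi> v (\<pi>R u w) = - \<pi>R \<lbrakk>v, u\<rbrakk> w"
    by (simp flip: commutator_pi_pi_R)
  also have "\<dots> = \<pi>R \<lbrakk>u, v\<rbrakk> w"
    by (simp only: L.bracket_skew[of u v] pi_R_uminus)
  finally show ?thesis .
qed

text \<open>
  The previous relation says that the commutator of \<open>\<pi>\<^sub>R(u)\<close> with the full series \<open>b(x)\<close> is already
  lower truncated, hence unchanged when \<open>b(x)\<close> is replaced by its regular part.
\<close>

lemma commutator_pi_R_pi_R: "\<pi>R u (\<pi>R v w) - \<pi>R v (\<pi>R u w) = \<pi>R \<lbrakk>u, v\<rbrakk> w"
proof (induction v arbitrary: w rule: affine_induct)
  case (elem b n)
  have "lower_truncated (\<lambda>n. \<pi>R \<lbrakk>u, affine_series b n\<rbrakk> w)"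
    using bracket_series_regular by (simp add: regular_part_of_def)
  then show ?case
    unfolding affine_elem_eq_series
    by (intro commutator_pi_R_series[OF pi_R_linear,
          where d = "\<lambda>n. \<pi>R \<lbrakk>u, affine_series b n\<rbrakk> w"])
      (simp only: commutator_pi_R_pi W.regular_part_refl)
next
  case (central c)
  show ?case
    using commutator_pi_R_pi[of u "(0, c)" w]
    by (simp add: pi_R_central pi_central)
next
  case (add v v')
  from arg_cong2[of _ _ _ _ "(+)", OF add(1)[of w] add(2)[of w]] show ?case
    by (simp add: pi_R_add pi_R_op_add L.bracket_add algebra_simps)
qed

lemma pi_R_op_diff: "\<pi>R u (v - w) = \<pi>R u v - \<pi>R u w"
  using pi_R_op_add[of u "v - w" w] by simp

lemma operator_diff: "\<pi> u (v - w) = \<pi> u v - \<pi> u w"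
  using operator_add[of u "v - w" w] by simp

lemma pi_R_pi_E_commute: "\<pi>R u (\<pi>E v w) = \<pi>E v (\<pi>R u w)"
proof -
  have "\<pi>R u (\<pi> v w) - \<pi> v (\<pi>R u w) = \<pi>R u (\<pi>R v w) - \<pi>R v (\<pi>R u w)"
    by (simp only: commutator_pi_R_pi commutator_pi_R_pi_R)
  then show ?thesis
    by (simp add: pi_E_eq pi_R_op_diff diff_eq_eq algebra_simps)
qed

lemma affine_module_pi_R: "affine_module sg br form sW \<pi>R"
  by (intro lie_module.intro lie_module_axioms.intro L.lie_algebra_axioms W.vector_space_axioms)
    (simp_all only: pi_R_linear pi_R_add pi_R_scale commutator_pi_R_pi_R)

lemma affine_module_pi_E: "affine_module sg br form sW \<pi>E"
proof (intro lie_module.intro lie_module_axioms.intro L.lie_algebra_axioms W.vector_space_axioms)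
  show "Vector_Spaces.linear sW sW (\<pi>E u)" for u
    by (simp add: Vector_Spaces.linear_iff W.vector_space_axioms pi_E_eq pi_R_op_add pi_R_op_scale
        operator_add operator_scale W.scale_right_diff_distrib)
  show "\<pi>E \<lbrakk>u, v\<rbrakk> w = \<pi>E u (\<pi>E v w) - \<pi>E v (\<pi>E u w)" for u v w
    using commutator_pi_R_pi[of u v w] commutator_pi_pi_R[of u v w] commutator_pi_R_pi_R[of u v w]
    by (simp add: pi_E_eq pi_R_op_diff operator_diff rep_bracket algebra_simps)
qed (simp_all add: pi_E_eq pi_R_add pi_R_scale rep_add rep_scale W.scale_right_diff_distrib)

text \<open>Multiplication by \<open>p\<close> does not distinguish a series from its regular part.\<close>

lemma poly_times_pi_E: "poly_times sW p (\<lambda>n. \<pi>E (affine_series a n) w) = (\<lambda>n. 0)"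
proof
  fix n
  have "poly_times sW p (\<lambda>n. \<pi> (affine_series a n) w) n =
      poly_times sW p (\<lambda>n. \<pi>R (affine_series a n) w) n + poly_times sW p (\<lambda>n. \<pi>E (affine_series a n) w) n"
    by (simp only: pi_decomposition W.poly_times_add)
  then show "poly_times sW p (\<lambda>n. \<pi>E (affine_series a n) w) n = 0"
    using pi_R_series_regular[of a w] by (simp add: regular_part_of_def)
qed

end


section \<open>The decomposition theorem\<close>

theorem theorem3p10:
  fixes sg :: "complex \<Rightarrow> 'g::ab_group_add \<Rightarrow> 'g"
    and br :: "'g \<Rightarrow> 'g \<Rightarrow> 'g"
    and form :: "'g \<Rightarrow> 'g \<Rightarrow> complex"
    and sW :: "complex \<Rightarrow> 'w::ab_group_add \<Rightarrow> 'w"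
    and \<pi> :: "'g affine \<Rightarrow> 'w \<Rightarrow> 'w"
  assumes "lie_algebra_with_form sg br form"
    and "category_C sg br form sW \<pi>"
  shows
    "(\<forall>u w. \<pi> u w = pi_R sW \<pi> u w + pi_E sW \<pi> u w) \<and>
     lie_module
       (prod_scale (affine_scale sg) (affine_scale sg))
       (prod_bracket (affine_bracket br form) (affine_bracket br form))
       sW (\<lambda>(u, v) w. pi_R sW \<pi> u w + pi_E sW \<pi> v w) \<and>
     (irreducible_lie_module (affine_scale sg) (affine_bracket br form) sW \<pi> \<longrightarrow>
      irreducible_lie_module
       (prod_scale (affine_scale sg) (affine_scale sg))
       (prod_bracket (affine_bracket br form) (affine_bracket br form))
       sW (\<lambda>(u, v) w. pi_R sW \<pi> u w + pi_E sW \<pi> v w)) \<and>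
     category_R sg br form sW (pi_R sW \<pi>) \<and>
     category_E sg br form sW (pi_E sW \<pi>)"
proof -
  obtain p where "category_C_module sg br form sW \<pi> p"
    using assms unfolding category_C_def category_C_module_def category_C_module_axioms_def by blast
  then interpret category_C_module sg br form sW \<pi> p .
  note sum_module = lie_module_of_commuting[OF affine_module_pi_R affine_module_pi_E pi_R_pi_E_commute]
  \<comment> \<open>The diagonal of the direct sum acts by the original representation.\<close>
  have "\<exists>x. (case x of (u, v) \<Rightarrow> \<lambda>w. \<pi>R u w + \<pi>E v w) = \<pi> u" for u
    by (rule exI[of _ "(u, u)"]) (simp add: fun_eq_iff pi_decomposition)
  from irreducible_lie_module_extend[OF _ sum_module this]
  have irreducible: "irreducible_lie_module (affine_scale sg) (affine_bracket br form) sW \<pi> \<Longrightarrow>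
      irreducible_lie_module
       (prod_scale (affine_scale sg) (affine_scale sg))
       (prod_bracket (affine_bracket br form) (affine_bracket br form))
       sW (\<lambda>(u, v) w. \<pi>R u w + \<pi>E v w)" .
  have "category_R sg br form sW \<pi>R"
    using affine_module_pi_R pi_R_series_regular by (simp add: category_R_def regular_part_of_def)
  moreover have "category_E sg br form sW \<pi>E"
    using affine_module_pi_E poly_times_pi_E p_nonzero by (auto simp: category_E_def)
  ultimately show ?thesis
    using pi_decomposition sum_module irreducible by blast
qed

end
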